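(* Let a planar $d$-web $W_d$ be formed by the level sets of web functions $f_1(x,y),\dots,f_d(x,y)$, where $x,y$ are coordinates in which the Christoffel symbols of the given (flat, torsion-free) connection vanish. Then $W_d$ is linear (in the coordinates $x,y$) if and only if each web function $f=f_1,\dots,f_d$ is a solution of the differential equation $$f_y^2f_{xx}-2f_xf_yf_{xy}+f_x^2f_{yy}=0 .$$
   Context: A planar $d$-web is given by $d$ foliations of a domain in the plane, pairwise transversal at every point, which are the level sets of smooth web functions $f_1,\dots,f_d$ with $df_i\wedge df_j\neq0$ for $i\ne j$ (in particular $df_i\ne0$). The web is linear in the coordinates $x,y$ if every leaf of each of its foliations is (an open part of) a straight line in these coordinates. *)

theory Defs
  imports "HOL-Analysis.Analysis"
begin

text \<open>
  The plane is \<^typ>\<open>real ^ 2\<close>; component 1 is the coordinate \<open>x\<close>, component 2 is \<open>y\<close>. Functions and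
  vector fields on a domain \<open>D\<close> are total functions of which only the restriction to the open
  set \<open>D\<close> matters.
\<close>

type_synonym plane = "real ^ 2"

definition planar_domain :: "plane set \<Rightarrow> bool" where
  "planar_domain D \<longleftrightarrow> open D \<and> connected D \<and> D \<noteq> {}"

primrec k_times_differentiable_on ::
    "nat \<Rightarrow> plane set \<Rightarrow> (plane \<Rightarrow> 'b::real_normed_vector) \<Rightarrow> bool" where
  "k_times_differentiable_on 0 D g \<longleftrightarrow> continuous_on D g"
| "k_times_differentiable_on (Suc k) D g \<longleftrightarrow>
     (\<forall>p\<in>D. g differentiable (at p)) \<and>
     (\<forall>v. k_times_differentiable_on k D (\<lambda>p. frechet_derivative g (at p) v))"

text \<open>\<open>C\<^sup>\<infinity>\<close> on an open set.\<close>

definition smooth_on :: "plane set \<Rightarrow> (plane \<Rightarrow> 'b::real_normed_vector) \<Rightarrow> bool" where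
  "smooth_on D g \<longleftrightarrow> (\<forall>k. k_times_differentiable_on k D g)"

definition partial :: "2 \<Rightarrow> (plane \<Rightarrow> real) \<Rightarrow> plane \<Rightarrow> real" where
  "partial i g p = frechet_derivative g (at p) (axis i 1)"

definition wedge ::
    "('v \<Rightarrow> real) \<Rightarrow> ('v \<Rightarrow> real) \<Rightarrow> 'v \<Rightarrow> 'v \<Rightarrow> real" (infixr "\<and>\<^sub>w" 70) where
  "(\<alpha> \<and>\<^sub>w \<beta>) u v = \<alpha> u * \<beta> v - \<alpha> v * \<beta> u"


subsection \<open>Affine connections on a plane domain\<close>

type_synonym vfield = "plane \<Rightarrow> plane"

definition lie_bracket :: "vfield \<Rightarrow> vfield \<Rightarrow> vfield" where
  "lie_bracket X Y p = frechet_derivative Y (at p) (X p) - frechet_derivative X (at p) (Y p)"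

definition affine_connection :: "plane set \<Rightarrow> (vfield \<Rightarrow> vfield \<Rightarrow> vfield) \<Rightarrow> bool" where
  "affine_connection D nabla \<longleftrightarrow>
     (\<forall>X Y. smooth_on D X \<longrightarrow> smooth_on D Y \<longrightarrow> smooth_on D (nabla X Y)) \<and>
     (\<forall>X X' Y. smooth_on D X \<longrightarrow> smooth_on D X' \<longrightarrow> smooth_on D Y \<longrightarrow>
        (\<forall>p\<in>D. nabla (\<lambda>q. X q + X' q) Y p = nabla X Y p + nabla X' Y p)) \<and>
     (\<forall>g X Y. smooth_on D g \<longrightarrow> smooth_on D X \<longrightarrow> smooth_on D Y \<longrightarrow>
        (\<forall>p\<in>D. nabla (\<lambda>q. g q *\<^sub>R X q) Y p = g p *\<^sub>R nabla X Y p)) \<and>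
     (\<forall>X Y Y'. smooth_on D X \<longrightarrow> smooth_on D Y \<longrightarrow> smooth_on D Y' \<longrightarrow>
        (\<forall>p\<in>D. nabla X (\<lambda>q. Y q + Y' q) p = nabla X Y p + nabla X Y' p)) \<and>
     (\<forall>g X Y. smooth_on D g \<longrightarrow> smooth_on D X \<longrightarrow> smooth_on D Y \<longrightarrow>
        (\<forall>p\<in>D. nabla X (\<lambda>q. g q *\<^sub>R Y q) p =
           frechet_derivative g (at p) (X p) *\<^sub>R Y p + g p *\<^sub>R nabla X Y p))"

definition torsion_free :: "plane set \<Rightarrow> (vfield \<Rightarrow> vfield \<Rightarrow> vfield) \<Rightarrow> bool" where
  "torsion_free D nabla \<longleftrightarrow>
     (\<forall>X Y. smooth_on D X \<longrightarrow> smooth_on D Y \<longrightarrow>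
        (\<forall>p\<in>D. nabla X Y p - nabla Y X p = lie_bracket X Y p))"

definition flat :: "plane set \<Rightarrow> (vfield \<Rightarrow> vfield \<Rightarrow> vfield) \<Rightarrow> bool" where
  "flat D nabla \<longleftrightarrow>
     (\<forall>X Y Z. smooth_on D X \<longrightarrow> smooth_on D Y \<longrightarrow> smooth_on D Z \<longrightarrow>
        (\<forall>p\<in>D. nabla X (nabla Y Z) p - nabla Y (nabla X Z) p - nabla (lie_bracket X Y) Z p = 0))"

text \<open>
  \<open>christoffel nabla k i j\<close> is \<open>\<Gamma>\<^sup>k\<^sub>i\<^sub>j\<close> in the standard coordinates: the \<open>k\<close>-th component of
  \<open>nabla\<close> of the \<open>j\<close>-th coordinate field in the direction of the \<open>i\<close>-th one.
\<close>

definition christoffel ::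
    "(vfield \<Rightarrow> vfield \<Rightarrow> vfield) \<Rightarrow> 2 \<Rightarrow> 2 \<Rightarrow> 2 \<Rightarrow> plane \<Rightarrow> real" where
  "christoffel nabla k i j p = nabla (\<lambda>_. axis i 1) (\<lambda>_. axis j 1) p $ k"


subsection \<open>Planar webs\<close>

text \<open>
  The condition on a single differential is stated separately because it does not follow from
  transversality when there is only one foliation.
\<close>

definition web_functions :: "plane set \<Rightarrow> nat \<Rightarrow> (nat \<Rightarrow> plane \<Rightarrow> real) \<Rightarrow> bool" where
  "web_functions D d f \<longleftrightarrow>
     (\<forall>i<d. smooth_on D (f i)) \<and>
     (\<forall>i<d. \<forall>p\<in>D. frechet_derivative (f i) (at p) \<noteq> (\<lambda>_. 0)) \<and>
     (\<forall>i<d. \<forall>j<d. i \<noteq> j \<longrightarrow>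
        (\<forall>p\<in>D. frechet_derivative (f i) (at p) \<and>\<^sub>w frechet_derivative (f j) (at p) \<noteq> (\<lambda>_ _. 0)))"

text \<open>
  A foliation is represented by its set of leaves. A level set in a non-convex domain may be
  disconnected; the leaves are its connected components.
\<close>

definition level_foliation :: "plane set \<Rightarrow> (plane \<Rightarrow> real) \<Rightarrow> plane set set" where
  "level_foliation D g = (\<Union>c. components {p \<in> D. g p = c})"

definition web_of :: "plane set \<Rightarrow> (nat \<Rightarrow> plane \<Rightarrow> real) \<Rightarrow> nat \<Rightarrow> plane set set" where
  "web_of D f i = level_foliation D (f i)"

definition straight_line :: "plane set \<Rightarrow> bool" where
  "straight_line l \<longleftrightarrow> affine l \<and> aff_dim l = 1"

definition linear_web :: "nat \<Rightarrow> (nat \<Rightarrow> plane set set) \<Rightarrow> bool" where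
  "linear_web d W \<longleftrightarrow>
     (\<forall>i<d. \<forall>L\<in>W i. \<exists>l. straight_line l \<and> openin (top_of_set l) L)"

end

theory Submission
  imports Defs
begin

text \<open>
  The left-hand side of the equation is the Hessian of \<open>g\<close> evaluated at the tangent \<open>(-g\<^sub>y, g\<^sub>x)\<close> of
  the level curve. It vanishes along a straight leaf by differentiating \<open>g\<close> twice along it.
  Conversely, let \<open>v\<close> span the kernel of \<open>dg\<close> at \<open>p\<close>. The equation turns \<open>w t = dg\<^sub>p\<^sub>+\<^sub>t\<^sub>v v\<close> into a
  solution of a homogeneous linear differential equation with \<open>w 0 = 0\<close>, so \<open>w\<close> vanishes and \<open>g\<close> is
  constant along the tangent line at \<open>p\<close>; since \<open>g\<close> is strictly monotone transversally to it, the
  level set through \<open>p\<close> coincides with this line near \<open>p\<close>. The tangent line is therefore locally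
  constant on a leaf, hence constant, and the leaf is an open part of it.
\<close>

section \<open>Uniqueness for a scalar linear differential equation\<close>

text \<open>A Gronwall-type argument: if \<open>K\<close> bounds the absolute value of
  \<open>c\<close>, then w^2 exp(-2Kt) is nonnegative, nonincreasing and starts at 0, so it is still
  0 at \<open>b\<close>.\<close>

lemma linear_ode_zero:
  fixes w c :: "real \<Rightarrow> real"
  assumes der: "\<And>t. a \<le> t \<Longrightarrow> t \<le> b \<Longrightarrow> (w has_real_derivative c t * w t) (at t)"
    and cont: "continuous_on {a..b} c" and "w a = 0" "a \<le> b"
  shows "w b = 0"
proof -
  have "bounded (c ` {a..b})"
    by (intro compact_imp_bounded compact_continuous_image cont compact_Icc)
  then obtain K where K: "\<And>t. a \<le> t \<Longrightarrow> t \<le> b \<Longrightarrow> \<bar>c t\<bar> \<le> K"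
    by (metis atLeastAtMost_iff bounded_iff image_eqI real_norm_def)
  define z where "z t = (w t)\<^sup>2 * exp (- 2 * K * t)" for t
  have "\<exists>y. (z has_real_derivative y) (at t) \<and> y \<le> 0" if t: "a \<le> t" "t \<le> b" for t
  proof (intro exI conjI)
    show "(z has_real_derivative 2 * (c t - K) * ((w t)\<^sup>2 * exp (- 2 * K * t))) (at t)"
      unfolding z_def
      by (rule derivative_eq_intros der[OF t] refl | simp add: algebra_simps power2_eq_square)+
    show "2 * (c t - K) * ((w t)\<^sup>2 * exp (- 2 * K * t)) \<le> 0"
      using K[OF t] by (auto simp: mult_le_0_iff)
  qed
  then have "z b \<le> z a"
    by (rule DERIV_nonpos_imp_nonincreasing[OF \<open>a \<le> b\<close>])
  then have "(w b)\<^sup>2 * exp (- 2 * K * b) \<le> 0"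
    using \<open>w a = 0\<close> by (simp add: z_def)
  then show ?thesis
    by (simp add: mult_le_0_iff)
qed

section \<open>Second-order calculus along lines\<close>

text \<open>\<open>g'' q u v\<close> differentiates first along \<open>u\<close>, then along
  \<open>v\<close>. Its symmetry is not assumed; it is derived from the continuity of each
  \<open>g'' q u v\<close> in \<open>q\<close>.\<close>

locale C2_on =
  fixes D :: "'a::real_normed_vector set" and g :: "'a \<Rightarrow> real"
    and g' :: "'a \<Rightarrow> 'a \<Rightarrow> real" and g'' :: "'a \<Rightarrow> 'a \<Rightarrow> 'a \<Rightarrow> real"
  assumes open_D: "open D"
    and deriv: "\<And>q. q \<in> D \<Longrightarrow> (g has_derivative g' q) (at q)"
    and deriv2: "\<And>q u. q \<in> D \<Longrightarrow> ((\<lambda>r. g' r u) has_derivative g'' q u) (at q)"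
    and cont2: "\<And>u v. continuous_on D (\<lambda>q. g'' q u v)"
begin

lemma deriv_along:
  assumes "x + t *\<^sub>R v \<in> D"
  shows "((\<lambda>t. g (x + t *\<^sub>R v)) has_real_derivative g' (x + t *\<^sub>R v) v) (at t)"
proof -
  have "((\<lambda>t. g (x + t *\<^sub>R v)) has_derivative (\<lambda>h. g' (x + t *\<^sub>R v) (h *\<^sub>R v))) (at t)"
    by (rule has_derivative_compose[where g = g]) (auto intro!: derivative_eq_intros deriv assms)
  then show ?thesis
    using has_derivative_linear[OF deriv[OF assms]]
    by (simp add: has_field_derivative_def linear_cmul mult_commute_abs)
qed

lemma deriv2_along:
  assumes "x + t *\<^sub>R v \<in> D"
  shows "((\<lambda>t. g' (x + t *\<^sub>R v) u) has_real_derivative g'' (x + t *\<^sub>R v) u v) (at t)"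
proof -
  have "((\<lambda>t. g' (x + t *\<^sub>R v) u) has_derivative (\<lambda>h. g'' (x + t *\<^sub>R v) u (h *\<^sub>R v))) (at t)"
    by (rule has_derivative_compose[where g = "\<lambda>r. g' r u"]) (auto intro!: derivative_eq_intros deriv2 assms)
  then show ?thesis
    using has_derivative_linear[OF deriv2[OF assms]]
    by (simp add: has_field_derivative_def linear_cmul mult_commute_abs)
qed

text \<open>The mean value theorem is applied twice: along \<open>u\<close> to the difference
  \<open>\<phi>\<close> of \<open>g\<close> on two opposite sides of the parallelogram, then along
  \<open>v\<close> to the derivative of \<open>g\<close> in direction \<open>u\<close>.\<close>

lemma second_difference:
  assumes "s > 0" and par: "\<And>a b. \<lbrakk>0 \<le> a; a \<le> s; 0 \<le> b; b \<le> s\<rbrakk> \<Longrightarrow> p + a *\<^sub>R u + b *\<^sub>R v \<in> D"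
  obtains a b where "0 < a" "a < s" "0 < b" "b < s"
    "g (p + s *\<^sub>R u + s *\<^sub>R v) - g (p + s *\<^sub>R u) - g (p + s *\<^sub>R v) + g p
      = s * s * g'' (p + a *\<^sub>R u + b *\<^sub>R v) u v"
proof -
  define \<phi> where "\<phi> a = g ((p + s *\<^sub>R v) + a *\<^sub>R u) - g (p + a *\<^sub>R u)" for a
  have "(\<phi> has_real_derivative g' ((p + s *\<^sub>R v) + a *\<^sub>R u) u - g' (p + a *\<^sub>R u) u) (at a)"
    if "0 \<le> a" "a \<le> s" for a
    unfolding \<phi>_def using par[of a s] par[of a 0] that \<open>s > 0\<close>
    by (intro DERIV_diff deriv_along) (auto simp: algebra_simps)
  from MVT2[OF \<open>s > 0\<close> this] obtain a where a: "0 < a" "a < s"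
    and 1: "\<phi> s - \<phi> 0 = s * (g' ((p + s *\<^sub>R v) + a *\<^sub>R u) u - g' (p + a *\<^sub>R u) u)" by auto
  have "((\<lambda>b. g' ((p + a *\<^sub>R u) + b *\<^sub>R v) u) has_real_derivative
      g'' (p + a *\<^sub>R u + b *\<^sub>R v) u v) (at b)" if "0 \<le> b" "b \<le> s" for b
    using par[of a b] a that by (intro deriv2_along) auto
  from MVT2[OF \<open>s > 0\<close> this] obtain b where b: "0 < b" "b < s"
    and 2: "g' (p + a *\<^sub>R u + s *\<^sub>R v) u - g' (p + a *\<^sub>R u) u = s * g'' (p + a *\<^sub>R u + b *\<^sub>R v) u v"
    by auto
  show thesis
    using 1 2 by (intro that[OF a b]) (simp add: \<phi>_def add_ac)
qed

text \<open>Schwarz's theorem: the second difference does not change when \<open>u\<close> and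
  \<open>v\<close> are swapped, so \<open>g''\<close> in one order equals \<open>g''\<close> in the
  other order at points arbitrarily close to \<open>p\<close>; continuity moves both values to
  \<open>p\<close>.\<close>

lemma deriv2_symmetric:
  assumes "p \<in> D"
  shows "g'' p u v = g'' p v u"
proof (rule ccontr)
  define e where "e = \<bar>g'' p u v - g'' p v u\<bar> / 2"
  assume "\<not> ?thesis"
  then have "e > 0" by (simp add: e_def)
  have near: "\<exists>\<delta>>0. \<forall>q. dist q p < \<delta> \<longrightarrow> q \<in> D \<and> \<bar>g'' q x y - g'' p x y\<bar> < e" for x y
  proof -
    have "continuous (at p) (\<lambda>q. g'' q x y)"
      using cont2 open_D assms continuous_on_eq_continuous_at by blast
    then obtain r where r: "r > 0" "\<And>q. dist q p < r \<Longrightarrow> \<bar>g'' q x y - g'' p x y\<bar> < e"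
      using \<open>e > 0\<close> unfolding continuous_at_eps_delta dist_real_def by blast
    obtain r' where r': "r' > 0" "ball p r' \<subseteq> D"
      using open_D assms open_contains_ball by blast
    show ?thesis
    proof (intro exI[of _ "min r r'"] conjI allI impI)
      fix q assume "dist q p < min r r'"
      then show "q \<in> D" "\<bar>g'' q x y - g'' p x y\<bar> < e"
        using r(2)[of q] r' by (auto simp: subset_iff dist_commute)
    qed (use r r' in auto)
  qed
  obtain \<delta>1 where 1: "\<delta>1 > 0" "\<And>q. dist q p < \<delta>1 \<Longrightarrow> q \<in> D \<and> \<bar>g'' q u v - g'' p u v\<bar> < e"
    using near by metis
  obtain \<delta>2 where 2: "\<delta>2 > 0" "\<And>q. dist q p < \<delta>2 \<Longrightarrow> q \<in> D \<and> \<bar>g'' q v u - g'' p v u\<bar> < e"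
    using near by metis
  define \<delta> where "\<delta> = min \<delta>1 \<delta>2"
  \<comment> \<open>The summand 1 keeps the denominator positive when \<open>u\<close> and
    \<open>v\<close> vanish and keeps the parallelogram strictly inside the
    \<open>\<delta>\<close>-ball.\<close>
  define s where "s = \<delta> / (norm u + norm v + 1)"
  have pos: "\<delta> > 0" "s > 0" using 1 2 by (auto simp: \<delta>_def s_def intro!: divide_pos_pos add_nonneg_pos)
  \<comment> \<open>Only the sum of the norms is fixed, so that the bound serves both orders of
    \<open>u\<close> and \<open>v\<close>.\<close>
  have close: "dist (p + a *\<^sub>R x + b *\<^sub>R y) p < \<delta>"
    if "0 \<le> a" "a \<le> s" "0 \<le> b" "b \<le> s" "norm x + norm y = norm u + norm v" for a b x y
  proof -
    have "dist (p + a *\<^sub>R x + b *\<^sub>R y) p \<le> norm (a *\<^sub>R x) + norm (b *\<^sub>R y)"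
      by (simp add: dist_norm add.assoc) (metis norm_triangle_ineq norm_scaleR)
    also have "\<dots> \<le> s * norm x + s * norm y"
      using that by (intro add_mono) (auto intro: mult_right_mono)
    also have "\<dots> = s * (norm u + norm v)"
      using that by (metis distrib_left)
    also have "\<dots> < s * (norm u + norm v + 1)" using pos by simp
    also have "\<dots> = \<delta>"
      unfolding s_def using norm_ge_zero[of u] norm_ge_zero[of v]
      by (intro nonzero_eq_divide_eq[THEN iffD1]) (auto simp: add_nonneg_eq_0_iff)
    finally show ?thesis .
  qed
  obtain a b where ab: "0 < a" "a < s" "0 < b" "b < s"
    "g (p + s *\<^sub>R u + s *\<^sub>R v) - g (p + s *\<^sub>R u) - g (p + s *\<^sub>R v) + g p
      = s * s * g'' (p + a *\<^sub>R u + b *\<^sub>R v) u v"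
  proof (rule second_difference[OF pos(2), of p u v])
    show "p + a *\<^sub>R u + b *\<^sub>R v \<in> D" if "0 \<le> a" "a \<le> s" "0 \<le> b" "b \<le> s" for a b
      using close[OF that, of u v] 1 by (simp add: \<delta>_def)
  qed
  obtain b' a' where ba: "0 < b'" "b' < s" "0 < a'" "a' < s"
    "g (p + s *\<^sub>R v + s *\<^sub>R u) - g (p + s *\<^sub>R v) - g (p + s *\<^sub>R u) + g p
      = s * s * g'' (p + b' *\<^sub>R v + a' *\<^sub>R u) v u"
  proof (rule second_difference[OF pos(2), of p v u])
    show "p + a *\<^sub>R v + b *\<^sub>R u \<in> D" if "0 \<le> a" "a \<le> s" "0 \<le> b" "b \<le> s" for a b
      using close[OF that, of v u] 1 by (simp add: \<delta>_def add.commute)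
  qed
  have "p + s *\<^sub>R v + s *\<^sub>R u = p + s *\<^sub>R u + s *\<^sub>R v" by (simp add: add_ac)
  with ab(5) ba(5) have "s * s * g'' (p + a *\<^sub>R u + b *\<^sub>R v) u v = s * s * g'' (p + b' *\<^sub>R v + a' *\<^sub>R u) v u"
    by (simp only:)
  then have eq: "g'' (p + a *\<^sub>R u + b *\<^sub>R v) u v = g'' (p + b' *\<^sub>R v + a' *\<^sub>R u) v u"
    using pos by simp
  have "\<bar>g'' (p + a *\<^sub>R u + b *\<^sub>R v) u v - g'' p u v\<bar> < e"
    using 1(2) close[of a b u v] ab by (simp add: \<delta>_def)
  moreover have "\<bar>g'' (p + b' *\<^sub>R v + a' *\<^sub>R u) v u - g'' p v u\<bar> < e"
    using 2(2) close[of b' a' v u] ba by (simp add: \<delta>_def add.commute)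
  \<comment> \<open>By \<open>eq\<close> a single number would lie within \<open>e\<close> of two
    values that are \<open>2 * e\<close> apart.\<close>
  ultimately show False
    using eq unfolding e_def by (smt (verit) field_sum_of_halves)
qed

lemma eq_along_segment:
  assumes "\<And>t. 0 \<le> t \<Longrightarrow> t \<le> 1 \<Longrightarrow> x + t *\<^sub>R v \<in> D"
  obtains t where "0 < t" "t < 1" "g (x + v) - g x = g' (x + t *\<^sub>R v) v"
  using MVT2[of 0 1 "\<lambda>t. g (x + t *\<^sub>R v)" "\<lambda>t. g' (x + t *\<^sub>R v) v"] deriv_along assms
  by auto

text \<open>Linearity in the last direction is that of a derivative; symmetry carries it over to the
  first direction.\<close>

lemma deriv2_bilinear:
  assumes "q \<in> D"
  shows "g'' q (x *\<^sub>R u + y *\<^sub>R v) w = x * g'' q u w + y * g'' q v w"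
    and "g'' q w (x *\<^sub>R u + y *\<^sub>R v) = x * g'' q w u + y * g'' q w v"
proof -
  show 2: "g'' q w (x *\<^sub>R u + y *\<^sub>R v) = x * g'' q w u + y * g'' q w v" for w
    using has_derivative_linear[OF deriv2[OF assms, of w]] by (simp add: linear_add linear_cmul)
  then show "g'' q (x *\<^sub>R u + y *\<^sub>R v) w = x * g'' q u w + y * g'' q v w"
    using deriv2_symmetric[OF assms] by metis
qed

lemma cont1: "continuous_on D (\<lambda>q. g' q u)"
  using has_derivative_continuous[OF deriv2] by (auto intro: continuous_at_imp_continuous_on)

end

section \<open>Coordinates and tangent lines of a regular plane function\<close>

locale regular_plane_function = C2_on D g g' g''
  for D :: "plane set" and g g' g'' +
  assumes regular: "\<And>q. q \<in> D \<Longrightarrow> g' q \<noteq> (\<lambda>_. 0)"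
begin

definition "gx q = g' q (axis 1 1)"
definition "gy q = g' q (axis 2 1)"
definition "gxx q = g'' q (axis 1 1) (axis 1 1)"
definition "gxy q = g'' q (axis 1 1) (axis 2 1)"
definition "gyy q = g'' q (axis 2 1) (axis 2 1)"

lemma continuous_on_partials:
  "continuous_on D gx" "continuous_on D gy"
  "continuous_on D gxx" "continuous_on D gxy" "continuous_on D gyy"
  unfolding gx_def gy_def gxx_def gxy_def gyy_def by (rule cont1 cont2)+

text \<open>Divided by the cube of the norm of the gradient, this is up to sign the curvature of the
  level curve.\<close>

definition level_curvature :: "plane \<Rightarrow> real" where
  "level_curvature q = (gy q)\<^sup>2 * gxx q - 2 * gx q * gy q * gxy q + (gx q)\<^sup>2 * gyy q"

definition tangent_line :: "plane \<Rightarrow> plane set" where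
  "tangent_line q = {x. g' q (x - q) = 0}"

lemma axis_expansion: "(v :: plane) = v $ 1 *\<^sub>R axis 1 1 + v $ 2 *\<^sub>R axis 2 1"
  by (simp add: vec_eq_iff forall_2 axis_def)

lemma deriv_coords:
  assumes "q \<in> D" shows "g' q v = v $ 1 * gx q + v $ 2 * gy q"
proof -
  have "linear (g' q)" by (rule has_derivative_linear[OF deriv[OF assms]])
  then show ?thesis
    by (subst axis_expansion[of v]) (simp add: linear_add linear_cmul gx_def gy_def)
qed

lemma deriv2_coords:
  assumes "q \<in> D"
  shows "g'' q v v = (v $ 1)\<^sup>2 * gxx q + 2 * (v $ 1) * (v $ 2) * gxy q + (v $ 2)\<^sup>2 * gyy q"
proof -
  have "g'' q v v = g'' q (v $ 1 *\<^sub>R axis 1 1 + v $ 2 *\<^sub>R axis 2 1) (v $ 1 *\<^sub>R axis 1 1 + v $ 2 *\<^sub>R axis 2 1)"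
    using axis_expansion[of v] by simp
  also have "\<dots> = (v $ 1)\<^sup>2 * gxx q + 2 * (v $ 1) * (v $ 2) * gxy q + (v $ 2)\<^sup>2 * gyy q"
    using deriv2_symmetric[OF assms, of "axis 2 1" "axis 1 1"]
    by (simp add: deriv2_bilinear[OF assms] gxx_def gxy_def gyy_def algebra_simps power2_eq_square)
  finally show ?thesis .
qed

lemma gradient_nonzero: "q \<in> D \<Longrightarrow> gx q \<noteq> 0 \<or> gy q \<noteq> 0"
  using regular[of q] deriv_coords[of q] by (auto simp: fun_eq_iff)

lemma gradient_norm_pos: "q \<in> D \<Longrightarrow> (gx q)\<^sup>2 + (gy q)\<^sup>2 > 0"
  using gradient_nonzero[of q] by (simp add: sum_power2_gt_zero_iff)

lemma tangent_line_self: "q \<in> D \<Longrightarrow> q \<in> tangent_line q"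
  by (simp add: tangent_line_def deriv_coords)

lemma straight_line_tangent_line:
  assumes "q \<in> D" shows "straight_line (tangent_line q)"
proof -
  define n :: plane where "n = vector [gx q, gy q]"
  have "n \<noteq> 0" using gradient_nonzero[OF assms] by (auto simp: n_def vec_eq_iff forall_2)
  have *: "tangent_line q = {x. n \<bullet> x = n \<bullet> q}"
    by (auto simp: tangent_line_def deriv_coords[OF assms] n_def inner_vec_def sum_2 algebra_simps)
  show ?thesis
    unfolding straight_line_def * using \<open>n \<noteq> 0\<close> by (simp add: affine_hyperplane)
qed

text \<open>If \<open>p\<close> and \<open>q\<close> differ, \<open>q - p\<close> spans the kernel
  of both differentials, so the gradients are parallel and both lines run through \<open>q\<close>
  in the same direction.\<close>

lemma tangent_line_eq:
  assumes "p \<in> D" "q \<in> D" "q \<in> tangent_line p" "g' q (q - p) = 0"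
  shows "tangent_line q = tangent_line p"
proof (cases "q = p")
  case False
  define v where "v = q - p"
  have v: "v $ 1 \<noteq> 0 \<or> v $ 2 \<noteq> 0" using False by (auto simp: v_def vec_eq_iff forall_2)
  have p: "v $ 1 * gx p + v $ 2 * gy p = 0" and q: "v $ 1 * gx q + v $ 2 * gy q = 0"
    using assms by (simp_all add: tangent_line_def deriv_coords v_def)
  have det: "gx p * gy q = gy p * gx q"
  proof -
    have "v $ 1 * (gx p * gy q - gy p * gx q)
        = gy q * (v $ 1 * gx p + v $ 2 * gy p) - gy p * (v $ 1 * gx q + v $ 2 * gy q)"
      and "v $ 2 * (gx p * gy q - gy p * gx q)
        = gx p * (v $ 1 * gx q + v $ 2 * gy q) - gx q * (v $ 1 * gx p + v $ 2 * gy p)"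
      by (simp_all add: algebra_simps)
    then show ?thesis using v unfolding p q by auto
  qed
  have "g' q (x - q) = 0 \<longleftrightarrow> g' p (x - p) = 0" for x
  proof -
    have 1: "g' p (x - p) = (x - q) $ 1 * gx p + (x - q) $ 2 * gy p"
      using p assms by (simp add: deriv_coords v_def algebra_simps)
    have 2: "g' q (x - q) = (x - q) $ 1 * gx q + (x - q) $ 2 * gy q"
      using assms by (simp add: deriv_coords)
    \<comment> \<open>Proportionality in cross-multiplied form: a nonzero component of the gradient
      at \<open>p\<close> yields one implication, one at \<open>q\<close> the other.\<close>
    have "gx p * g' q (x - q) = gx q * g' p (x - p)" "gy p * g' q (x - q) = gy q * g' p (x - p)"
      unfolding 1 2 using det by algebra+
    then show ?thesis
      using gradient_nonzero[OF assms(1)] gradient_nonzero[OF assms(2)] by auto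
  qed
  then show ?thesis by (simp add: tangent_line_def)
qed simp

section \<open>Vanishing curvature makes the leaves straight\<close>

text \<open>With N = (a, b), T = (-b, a) and v = (x, y), expand the quadratic form H at |N|^2 v =
  (v.N) N + (v.T) T. The terms with H(N,N) and H(N,T) share the factor v.N; the remaining one is
  (v.T)^2 H(T,T).\<close>

lemma hessian_split:
  fixes x y a b A B C :: real
  shows "(x\<^sup>2 * A + 2 * x * y * B + y\<^sup>2 * C) * (a\<^sup>2 + b\<^sup>2)\<^sup>2
    = ((x * a + y * b) * (a\<^sup>2 * A + 2 * a * b * B + b\<^sup>2 * C)
        + 2 * (a * y - b * x) * (a * b * (C - A) + (a\<^sup>2 - b\<^sup>2) * B)) * (x * a + y * b)
      + (a * y - b * x)\<^sup>2 * (b\<^sup>2 * A - 2 * a * b * B + a\<^sup>2 * C)"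
  by algebra

text \<open>
  Splitting \<open>v\<close> into its parts along the gradient and along the level curve, the hypothesis kills
  the term of \<open>g'' v v\<close> that does not contain the gradient part \<open>g' v\<close>. So \<open>g' v\<close> satisfies a
  homogeneous linear differential equation along the line in direction \<open>v\<close>.
\<close>

lemma tangent_direction_constant:
  assumes curv: "\<And>q. q \<in> D \<Longrightarrow> level_curvature q = 0"
    and seg: "\<And>t. 0 \<le> t \<Longrightarrow> t \<le> 1 \<Longrightarrow> p + t *\<^sub>R v \<in> D"
    and "g' p v = 0" "0 \<le> t" "t \<le> 1"
  shows "g' (p + t *\<^sub>R v) v = 0"
proof -
  \<comment> \<open>The cofactor of \<open>g' q v\<close> in \<open>hessian_split\<close>, divided
    by the fourth power of the norm of the gradient; it is continuous because the gradient has no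
    zero in \<open>D\<close>.\<close>
  define c where "c q = (g' q v * ((gx q)\<^sup>2 * gxx q + 2 * gx q * gy q * gxy q + (gy q)\<^sup>2 * gyy q)
      + 2 * (gx q * v $ 2 - gy q * v $ 1)
          * (gx q * gy q * (gyy q - gxx q) + ((gx q)\<^sup>2 - (gy q)\<^sup>2) * gxy q))
      / ((gx q)\<^sup>2 + (gy q)\<^sup>2)\<^sup>2" for q
  have "continuous_on D c"
    unfolding c_def using gradient_norm_pos by (intro continuous_intros cont1 continuous_on_partials) fastforce
  then have "continuous_on {0..t} (\<lambda>t. c (p + t *\<^sub>R v))"
    by (rule continuous_on_compose2) (use seg assms in \<open>auto intro!: continuous_intros\<close>)
  moreover have "((\<lambda>t. g' (p + t *\<^sub>R v) v) has_real_derivative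
      c (p + s *\<^sub>R v) * g' (p + s *\<^sub>R v) v) (at s)" if "0 \<le> s" "s \<le> t" for s
  proof -
    define q where "q = p + s *\<^sub>R v"
    have "q \<in> D" using seg that assms by (simp add: q_def)
    note nz = gradient_norm_pos[OF this]
    have curv_q: "(gy q)\<^sup>2 * gxx q - 2 * gx q * gy q * gxy q + (gx q)\<^sup>2 * gyy q = 0"
      using curv[OF \<open>q \<in> D\<close>] by (simp add: level_curvature_def)
    have "g'' q v v * ((gx q)\<^sup>2 + (gy q)\<^sup>2)\<^sup>2
      = (g' q v * ((gx q)\<^sup>2 * gxx q + 2 * gx q * gy q * gxy q + (gy q)\<^sup>2 * gyy q)
      + 2 * (gx q * v $ 2 - gy q * v $ 1)
          * (gx q * gy q * (gyy q - gxx q) + ((gx q)\<^sup>2 - (gy q)\<^sup>2) * gxy q)) * g' q v"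
      unfolding deriv2_coords[OF \<open>q \<in> D\<close>] deriv_coords[OF \<open>q \<in> D\<close>, of v]
      using hessian_split[of "v $ 1" "gxx q" "v $ 2" "gxy q" "gyy q" "gx q" "gy q"]
      unfolding curv_q by simp
    then have "g'' q v v = c q * g' q v"
      unfolding c_def times_divide_eq_left by (rule eq_divide_imp[rotated]) (use nz in auto)
    then show ?thesis
      using deriv2_along[of p s v v] \<open>q \<in> D\<close> by (simp add: q_def)
  qed
  ultimately show ?thesis
    using linear_ode_zero[of 0 t "\<lambda>t. g' (p + t *\<^sub>R v) v" "\<lambda>t. c (p + t *\<^sub>R v)"] assms by simp
qed

lemma level_set_locally_straight:
  assumes curv: "\<And>q. q \<in> D \<Longrightarrow> level_curvature q = 0" and "p \<in> D"
  obtains e where "e > 0" "ball p e \<subseteq> D"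
    "{q \<in> ball p e. g q = g p} = tangent_line p \<inter> ball p e"
    "\<And>q. q \<in> tangent_line p \<inter> ball p e \<Longrightarrow> tangent_line q = tangent_line p"
proof -
  define n :: plane where "n = vector [gx p, gy p]"
  have gn: "g' p x = n \<bullet> x" for x
    by (simp add: deriv_coords[OF \<open>p \<in> D\<close>] n_def inner_vec_def sum_2 mult.commute)
  have "n \<bullet> n > 0"
    using gradient_nonzero[OF \<open>p \<in> D\<close>] by (auto simp: n_def vec_eq_iff forall_2)
  \<comment> \<open>At \<open>p\<close> the derivative along the gradient \<open>n\<close> is
    \<open>n \<bullet> n\<close>, so it stays positive on a small ball: there \<open>g\<close>
    increases strictly in the fixed direction \<open>n\<close>.\<close>
  have "open (D \<inter> (\<lambda>q. g' q n) -` {0<..})"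
    by (intro continuous_open_preimage cont1 open_D open_greaterThan)
  moreover have "p \<in> D \<inter> (\<lambda>q. g' q n) -` {0<..}"
    using \<open>p \<in> D\<close> \<open>n \<bullet> n > 0\<close> by (simp add: gn)
  ultimately obtain e where "e > 0" and e: "ball p e \<subseteq> D \<inter> (\<lambda>q. g' q n) -` {0<..}"
    using open_contains_ball by blast
  have conv: "x + t *\<^sub>R v \<in> ball p e"
    if "x \<in> ball p e" "x + v \<in> ball p e" "0 \<le> t" "t \<le> 1" for x v t
  proof -
    have "(1 - t) *\<^sub>R x + t *\<^sub>R (x + v) \<in> ball p e"
      using that convexD_alt[OF convex_ball] by blast
    then show ?thesis by (simp add: algebra_simps)
  qed
  \<comment> \<open>The derivative along \<open>q - p\<close> vanishes on the whole segment. Its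
    interior points give \<open>g q = g p\<close>, its endpoint \<open>q\<close> gives the equality
    of tangent lines.\<close>
  have tangent: "g q = g p \<and> g' q (q - p) = 0" if q: "q \<in> tangent_line p \<inter> ball p e" for q
  proof -
    have seg: "p + t *\<^sub>R (q - p) \<in> D" if "0 \<le> t" "t \<le> 1" for t
      using conv[of p "q - p" t] q that e \<open>e > 0\<close> by auto
    have "g' p (q - p) = 0" using q by (simp add: tangent_line_def)
    note const = tangent_direction_constant[OF curv seg this]
    obtain t where "0 < t" "t < 1" "g (p + (q - p)) - g p = g' (p + t *\<^sub>R (q - p)) (q - p)"
      using eq_along_segment[OF seg] .
    then show ?thesis using const[of t] const[of 1] by simp
  qed
  have level: "q \<in> tangent_line p" if q: "q \<in> ball p e" "g q = g p" for q
  proof -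
    \<comment> \<open>\<open>x\<close> is the orthogonal projection of \<open>q\<close> to the
      tangent line; by Pythagoras it does not leave the ball.\<close>
    define r where "r = (n \<bullet> (q - p)) / (n \<bullet> n)"
    define x where "x = q - r *\<^sub>R n"
    have orth: "n \<bullet> (x - p) = 0"
      using \<open>n \<bullet> n > 0\<close> by (simp add: x_def r_def inner_diff_right)
    then have "(norm (x - p))\<^sup>2 + (norm (r *\<^sub>R n))\<^sup>2 = (norm (q - p))\<^sup>2"
      using norm_add_Pythagorean[of "x - p" "r *\<^sub>R n"]
      by (simp add: orthogonal_def inner_commute x_def)
    then have "norm (x - p) \<le> norm (q - p)"
      by (smt (verit) norm_ge_zero power2_le_imp_le zero_le_power2)
    then have x: "x \<in> ball p e" using q by (simp add: dist_norm norm_minus_commute)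
    have "x \<in> tangent_line p" using orth by (simp add: tangent_line_def gn)
    then have "g x = g p" using tangent x by blast
    have "x + r *\<^sub>R n = q" by (simp add: x_def)
    have ball: "x + t *\<^sub>R (r *\<^sub>R n) \<in> ball p e" if "0 \<le> t" "t \<le> 1" for t
      using conv[of x "r *\<^sub>R n" t] x q that \<open>x + r *\<^sub>R n = q\<close> by simp
    then have "x + t *\<^sub>R (r *\<^sub>R n) \<in> D" if "0 \<le> t" "t \<le> 1" for t
      using that e by blast
    then obtain t where t: "0 < t" "t < 1"
      "g (x + r *\<^sub>R n) - g x = g' (x + t *\<^sub>R (r *\<^sub>R n)) (r *\<^sub>R n)"
      by (rule eq_along_segment)
    \<comment> \<open>Since \<open>g\<close> agrees at \<open>x\<close> and \<open>q\<close>, its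
      derivative along \<open>r *\<^sub>R n\<close> vanishes somewhere between them, which the
      positive derivative along \<open>n\<close> permits only for \<open>r = 0\<close>.\<close>
    define y where "y = x + t *\<^sub>R (r *\<^sub>R n)"
    have "y \<in> D" "g' y n > 0" using ball[of t] t e by (auto simp: y_def)
    moreover have "g' y (r *\<^sub>R n) = 0"
      using t(3) \<open>g x = g p\<close> \<open>g q = g p\<close> \<open>x + r *\<^sub>R n = q\<close> by (simp add: y_def)
    moreover have "g' y (r *\<^sub>R n) = r * g' y n"
      using has_derivative_linear[OF deriv[OF \<open>y \<in> D\<close>]] by (simp add: linear_cmul)
    ultimately have "r = 0" by simp
    then show ?thesis using \<open>x \<in> tangent_line p\<close> by (simp add: x_def)
  qed
  show thesis
  proof (rule that[OF \<open>e > 0\<close>])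
    show "ball p e \<subseteq> D" using e by blast
    show "{q \<in> ball p e. g q = g p} = tangent_line p \<inter> ball p e"
      using tangent level by blast
    show "tangent_line q = tangent_line p" if "q \<in> tangent_line p \<inter> ball p e" for q
      using tangent_line_eq[OF \<open>p \<in> D\<close>, of q] tangent[OF that] that e by blast
  qed
qed

text \<open>Both features of a component are used: connectedness makes the locally constant tangent
  line constant on \<open>L\<close>, and maximality makes \<open>L\<close> open in that
  line.\<close>

lemma leaf_straight:
  assumes curv: "\<And>q. q \<in> D \<Longrightarrow> level_curvature q = 0" and L: "L \<in> level_foliation D g"
  shows "\<exists>l. straight_line l \<and> openin (top_of_set l) L"
proof -
  obtain c where c: "L \<in> components {p \<in> D. g p = c}"
    using L by (auto simp: level_foliation_def)
  note sub = in_components_subset[OF c] and conn = in_components_connected[OF c]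
  obtain p where "p \<in> L" using in_components_nonempty[OF c] by blast
  have "eventually (\<lambda>y. tangent_line q = tangent_line y) (at q within L)" if "q \<in> L" for q
  proof -
    have q: "q \<in> D" "g q = c" using that sub by auto
    obtain e where e: "e > 0" "ball q e \<subseteq> D"
      "{y \<in> ball q e. g y = g q} = tangent_line q \<inter> ball q e"
      "\<And>y. y \<in> tangent_line q \<inter> ball q e \<Longrightarrow> tangent_line y = tangent_line q"
      using level_set_locally_straight[OF curv q(1)] by blast
    have "tangent_line q = tangent_line y" if "y \<in> L" "dist y q < e" for y
    proof -
      have "y \<in> {y \<in> ball q e. g y = g q}" using that sub q by (auto simp: dist_commute)
      then show ?thesis unfolding e(3) by (rule e(4)[symmetric])
    qed
    then show ?thesis
      using \<open>e > 0\<close> by (auto simp: eventually_at)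
  qed
  then have same: "tangent_line q = tangent_line p" if "q \<in> L" for q
    using connected_local_const[OF conn \<open>p \<in> L\<close> that, of tangent_line] by auto
  have "openin (top_of_set (tangent_line p)) L"
    unfolding openin_contains_ball
  proof (intro conjI ballI)
    show "L \<subseteq> tangent_line p"
      using same tangent_line_self sub by blast
    fix q assume "q \<in> L"
    then have q: "q \<in> D" "g q = c" using sub by auto
    obtain e where e: "e > 0" "ball q e \<subseteq> D"
      "{y \<in> ball q e. g y = g q} = tangent_line q \<inter> ball q e"
      by (rule level_set_locally_straight[OF curv q(1)])
    have "convex (tangent_line q)"
      using straight_line_tangent_line[OF q(1)] by (simp add: straight_line_def affine_imp_convex)
    then have "connected (tangent_line q \<inter> ball q e)"
      by (intro convex_connected convex_Int convex_ball)
    moreover have "tangent_line q \<inter> ball q e \<subseteq> {p \<in> D. g p = c}"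
      using e q by blast
    moreover have "L \<inter> (tangent_line q \<inter> ball q e) \<noteq> {}"
      using \<open>q \<in> L\<close> tangent_line_self[OF q(1)] e(1) by auto
    \<comment> \<open>This piece of the line is a connected part of the level set that meets
      \<open>L\<close>.\<close>
    ultimately have "tangent_line q \<inter> ball q e \<subseteq> L"
      using components_maximal[OF c] by blast
    then show "\<exists>e>0. ball q e \<inter> tangent_line p \<subseteq> L"
      using same[OF \<open>q \<in> L\<close>] \<open>e > 0\<close> by blast
  qed
  moreover have "straight_line (tangent_line p)"
    using straight_line_tangent_line \<open>p \<in> L\<close> sub by blast
  ultimately show ?thesis by blast
qed

section \<open>Straight leaves make the curvature vanish\<close>

lemma level_curvature_eq_0_if_constant_along:
  assumes "p \<in> D" "v \<noteq> 0" "e > 0"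
    and const: "\<And>t. \<bar>t\<bar> < e \<Longrightarrow> p + t *\<^sub>R v \<in> D \<and> g (p + t *\<^sub>R v) = g p"
  shows "level_curvature p = 0"
proof -
  have 1: "g' (p + t *\<^sub>R v) v = 0" if "\<bar>t\<bar> < e" for t
  proof -
    have "((\<lambda>t. g p) has_real_derivative g' (p + t *\<^sub>R v) v) (at t)"
      by (rule has_field_derivative_transform_within_open[OF deriv_along, of _ _ _ "{-e<..<e}"])
        (use that const in auto)
    then show ?thesis using DERIV_unique DERIV_const by blast
  qed
  \<comment> \<open>The first derivative along the segment vanishes near 0 and not only at 0, so it
    can be differentiated again.\<close>
  have "((\<lambda>t. 0) has_real_derivative g'' (p + 0 *\<^sub>R v) v v) (at 0)"
    by (rule has_field_derivative_transform_within_open[OF deriv2_along, of _ _ _ "{-e<..<e}"])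
      (use 1 assms in auto)
  then have "g'' p v v = 0" using DERIV_unique[OF _ DERIV_const] by fastforce
  then have *: "(v $ 1)\<^sup>2 * gxx p + 2 * (v $ 1) * (v $ 2) * gxy p + (v $ 2)\<^sup>2 * gyy p = 0"
    by (simp add: deriv2_coords[OF \<open>p \<in> D\<close>])
  have **: "v $ 1 * gx p + v $ 2 * gy p = 0"
    using 1[of 0] \<open>e > 0\<close> by (simp add: deriv_coords[OF \<open>p \<in> D\<close>])
  \<comment> \<open>As \<open>v\<close> is in the kernel of \<open>g' p\<close>, it is a multiple of
    (-g_y, g_x), so the Hessian at \<open>v\<close> is proportional to the curvature. Multiplying by
    squared components of \<open>v\<close> expresses this without division.\<close>
  have "(v $ 1)\<^sup>2 * level_curvature p = 0" "(v $ 2)\<^sup>2 * level_curvature p = 0"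
  proof -
    have "(v $ 1)\<^sup>2 * level_curvature p
      = (gy p)\<^sup>2 * ((v $ 1)\<^sup>2 * gxx p + 2 * (v $ 1) * (v $ 2) * gxy p + (v $ 2)\<^sup>2 * gyy p)
        + (v $ 1 * gx p + v $ 2 * gy p) * ((gx p * v $ 1 - gy p * v $ 2) * gyy p - 2 * gy p * v $ 1 * gxy p)"
      and "(v $ 2)\<^sup>2 * level_curvature p
      = (gx p)\<^sup>2 * ((v $ 1)\<^sup>2 * gxx p + 2 * (v $ 1) * (v $ 2) * gxy p + (v $ 2)\<^sup>2 * gyy p)
        + (v $ 1 * gx p + v $ 2 * gy p) * ((gy p * v $ 2 - gx p * v $ 1) * gxx p - 2 * gx p * v $ 2 * gxy p)"
      unfolding level_curvature_def by algebra+
    then show "(v $ 1)\<^sup>2 * level_curvature p = 0" "(v $ 2)\<^sup>2 * level_curvature p = 0"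
      unfolding * ** by simp_all
  qed
  moreover have "v $ 1 \<noteq> 0 \<or> v $ 2 \<noteq> 0"
    using \<open>v \<noteq> 0\<close> by (auto simp: vec_eq_iff forall_2)
  ultimately show ?thesis by auto
qed

lemma level_curvature_eq_0_if_straight_leaves:
  assumes "\<And>L. L \<in> level_foliation D g \<Longrightarrow> \<exists>l. straight_line l \<and> openin (top_of_set l) L"
    and "p \<in> D"
  shows "level_curvature p = 0"
proof -
  define S where "S = {q \<in> D. g q = g p}"
  have "p \<in> S" using \<open>p \<in> D\<close> by (simp add: S_def)
  define L where "L = connected_component_set S p"
  have "p \<in> L" "L \<subseteq> S"
    using \<open>p \<in> S\<close> by (auto simp: L_def connected_component_subset)
  have "L \<in> components S" using \<open>p \<in> S\<close> by (simp add: L_def componentsI)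
  then have "L \<in> level_foliation D g" by (auto simp: level_foliation_def S_def)
  then obtain l where l: "affine l" "aff_dim l = 1" "openin (top_of_set l) L"
    using assms(1) unfolding straight_line_def by blast
  have "p \<in> l" using openin_imp_subset[OF l(3)] \<open>p \<in> L\<close> by blast
  \<comment> \<open>A second point of the line supplies its direction \<open>v\<close>.\<close>
  have "l \<noteq> {p}" using l(2) by auto
  then obtain y where "y \<in> l" "y \<noteq> p" using \<open>p \<in> l\<close> by blast
  obtain e where e: "e > 0" "ball p e \<inter> l \<subseteq> L"
    using l(3) \<open>p \<in> L\<close> unfolding openin_contains_ball by blast
  define v where "v = y - p"
  have "v \<noteq> 0" using \<open>y \<noteq> p\<close> by (simp add: v_def)
  \<comment> \<open>For these \<open>t\<close> the displacement is shorter than \<open>e\<close>, so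
    the point stays in the leaf.\<close>
  have "p + t *\<^sub>R v \<in> D \<and> g (p + t *\<^sub>R v) = g p" if t: "\<bar>t\<bar> < e / norm v" for t
  proof -
    have "(1 - t) *\<^sub>R p + t *\<^sub>R y \<in> l"
      using l(1) \<open>p \<in> l\<close> \<open>y \<in> l\<close> by (simp add: affine_alt)
    then have "p + t *\<^sub>R v \<in> l" by (simp add: v_def algebra_simps)
    moreover have "p + t *\<^sub>R v \<in> ball p e"
      using t \<open>v \<noteq> 0\<close> by (simp add: dist_norm field_simps)
    ultimately have "p + t *\<^sub>R v \<in> S" using e \<open>L \<subseteq> S\<close> by blast
    then show ?thesis by (simp add: S_def)
  qed
  moreover have "e / norm v > 0" using e \<open>v \<noteq> 0\<close> by simp
  ultimately show ?thesis
    using level_curvature_eq_0_if_constant_along[OF \<open>p \<in> D\<close> \<open>v \<noteq> 0\<close>] by blast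
qed

lemma leaves_straight_iff:
  "(\<forall>L\<in>level_foliation D g. \<exists>l. straight_line l \<and> openin (top_of_set l) L)
    \<longleftrightarrow> (\<forall>p\<in>D. level_curvature p = 0)"
  using leaf_straight level_curvature_eq_0_if_straight_leaves by blast

end

section \<open>Application to webs\<close>

lemma smooth_on_C2:
  assumes "open D" "smooth_on D g"
  shows "C2_on D g (\<lambda>q. frechet_derivative g (at q))
    (\<lambda>q u. frechet_derivative (\<lambda>r. frechet_derivative g (at r) u) (at q))"
proof -
  have "k_times_differentiable_on (Suc (Suc 0)) D g"
    using assms(2) unfolding smooth_on_def by blast
  then show ?thesis
    using assms(1) by unfold_locales (auto simp: frechet_derivative_works)
qed

theorem theorem14:
  fixes D :: "plane set"
    and nabla :: "vfield \<Rightarrow> vfield \<Rightarrow> vfield"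
    and d :: nat
    and f :: "nat \<Rightarrow> plane \<Rightarrow> real"
  assumes "planar_domain D"
    and "affine_connection D nabla"
    and "torsion_free D nabla"
    and "flat D nabla"
    and "\<forall>k i j. \<forall>p\<in>D. christoffel nabla k i j p = 0"
    and "web_functions D d f"
  shows "linear_web d (web_of D f) \<longleftrightarrow>
    (\<forall>i<d. \<forall>p\<in>D.
        (partial 2 (f i) p)\<^sup>2 * partial 1 (partial 1 (f i)) p
      - 2 * partial 1 (f i) p * partial 2 (f i) p * partial 2 (partial 1 (f i)) p
      + (partial 1 (f i) p)\<^sup>2 * partial 2 (partial 2 (f i)) p = 0)"
proof -
  let ?g' = "\<lambda>i q. frechet_derivative (f i) (at q)"
  let ?g'' = "\<lambda>i q u. frechet_derivative (\<lambda>r. frechet_derivative (f i) (at r) u) (at q)"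
  have reg: "regular_plane_function D (f i) (?g' i) (?g'' i)" if "i < d" for i
  proof -
    interpret C2_on D "f i" "?g' i" "?g'' i"
      using assms that by (intro smooth_on_C2) (auto simp: planar_domain_def web_functions_def)
    show ?thesis
      using assms(6) that by unfold_locales (auto simp: web_functions_def)
  qed
  \<comment> \<open>Linearity and the equation are compared one foliation at a time. By the order of
    directions in \<open>g''\<close>, \<open>gxy\<close> is
    \<open>partial 2 (partial 1 (f i))\<close>.\<close>
  show ?thesis
    unfolding linear_web_def web_of_def partial_def
    using regular_plane_function.leaves_straight_iff[OF reg]
    by (simp add: regular_plane_function.level_curvature_def[OF reg]
        regular_plane_function.gx_def[OF reg] regular_plane_function.gy_def[OF reg]
        regular_plane_function.gxx_def[OF reg] regular_plane_function.gxy_def[OF reg]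
        regular_plane_function.gyy_def[OF reg])
qed

end
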